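(* Let $\lambda\in\binom{[n]}{k}$ and consider the finite pipe dream shape $S'_\lambda$ whose distinguished path (lower boundary) is given by $\lambda$. However the cells of $S'_\lambda$ are filled with crosses and elbows to form a finite pipe dream, the resulting bounded affine permutation $g$ has first Grassmann necklace element $I_1$ satisfying $I_1=\lambda$.
   Context: The distinguished path of $\lambda$ is the lattice path from $(0,0)$ to $(n-k,-k)$ with steps numbered $1,\dots,n$, step $i$ going one unit South if $i\in\lambda$ and one unit East if $i\notin\lambda$. The finite pipe dream shape $S'_\lambda$ is the set of unit cells of the rectangle $[0,n-k]\times[-k,0]$ that lie above (northeast of) this path. A finite pipe dream is a filling of $S'_\lambda$ with cross tiles (strands connect West–East and South–North) and elbow tiles (strands connect West–North and South–East). Its bounded affine permutation $g$ is defined by embedding it in an affine pipe dream: extend the distinguished path to the bi-infinite path $P_\lambda$ with steps numbered by $\mathbb{Z}$ (step $i$ South iff $i\bmod n\in\lambda$), invariant under translation by $\tau=(n-k,-k)$, and consider the strip of unit cells between the lower boundary $P_\lambda$ and the upper boundary $P_\lambda+(0,k)$ (translate of $P_\lambda$ up by $k$, each step keeping its number; as a set of points it equals $P_\lambda+(n-k,0)$). Fill $S'_\lambda$ and all its translates by multiples of $\tau$ with the given filling and every other cell of the strip with a cross. Then the pipe entering at step $i$ of the lower boundary and travelling north and east leaves at step $g(i)$ of the upper boundary. This $g:\mathbb{Z}\to\mathbb{Z}$ is a bijection with $g(i+n)=g(i)+n$, $i\le g(i)\le i+n$, $\frac1n\sum_{i=1}^n(g(i)-i)=k$. The positroid variety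 $\Pi_g\subseteq Gr(k,n)$ consists of row spans of full-rank complex $k\times n$ matrices $M$ (columns extended periodically mod $n$) such that for all $i\le j\le i+n$ the rank of columns $i,\dots,j$ is at most $(j-i+1)-\#\{a\ge i: g(a)\le j\}$. The first Grassmann necklace element $I_1$ of $g$ is the minimal (in Gale order with $1<2<\dots<n$, equivalently lexicographically minimal) $k$-subset of $[n]$ whose maximal minor is nonzero for a generic point of $\Pi_g$, i.e. the first $k$ linearly independent columns, reading from column $1$, of a generic matrix representative; equivalently $I_1=\{j\in[n]: g^{-1}(j)\le 0\}$. *)

theory Defs
  imports "Jordan_Normal_Form.DL_Rank"
begin

section \<open>The distinguished path and pipe dreams\<close>

text \<open>Steps are numbered by integers; \<^term>\<open>[n]\<close> is rendered as \<^term>\<open>{1..int n}\<close>, and residues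
  modulo \<^term>\<open>n\<close> are represented in that set.\<close>

definition is_south :: "nat \<Rightarrow> int set \<Rightarrow> int \<Rightarrow> bool" where
  "is_south n lam i \<longleftrightarrow> (i - 1) mod int n + 1 \<in> lam"

text \<open>The increment from \<^term>\<open>0\<close> to \<^term>\<open>i\<close> of a step-counting function; for every
  \<^term>\<open>i\<close> at least one of the two sets is empty.\<close>

definition signed_count :: "(int \<Rightarrow> bool) \<Rightarrow> int \<Rightarrow> int" where
  "signed_count P i = int (card {a \<in> {1..i}. P a}) - int (card {a \<in> {i + 1..0}. P a})"

text \<open>The vertex of the bi-infinite path between step \<^term>\<open>i\<close> and step \<^term>\<open>i + 1\<close>;
  the vertex with index \<^term>\<open>0\<close> is the origin.\<close>

definition path_vertex :: "nat \<Rightarrow> int set \<Rightarrow> int \<Rightarrow> int \<times> int" where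
  "path_vertex n lam i =
     (signed_count (\<lambda>a. \<not> is_south n lam a) i, - signed_count (is_south n lam) i)"

text \<open>A unit cell is named by its lower left corner.  It lies above the path iff it lies above
  the East step of the path in its column.\<close>

definition pipe_shape :: "nat \<Rightarrow> nat \<Rightarrow> int set \<Rightarrow> (int \<times> int) set" where
  "pipe_shape k n lam =
     {(x, y). 0 \<le> x \<and> x < int n - int k \<and> - int k \<le> y \<and> y < 0 \<and>
        (\<exists>i \<in> {1..int n}. \<not> is_south n lam i \<and>
           fst (path_vertex n lam (i - 1)) = x \<and> snd (path_vertex n lam (i - 1)) \<le> y)}"

datatype tile = Cross | Elbow

text \<open>A finite pipe dream is given by a function on all cells, of which only the values on
  \<^const>\<open>pipe_shape\<close> are used.  The affine pipe dream copies them to the translates of the shape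
  by multiples of \<^term>\<open>(int n - int k, - int k)\<close> and has crosses elsewhere.  (It is also
  given a value on the cells outside the strip; pipes never enter them, see below.)\<close>

definition affine_tile ::
  "nat \<Rightarrow> nat \<Rightarrow> int set \<Rightarrow> (int \<times> int \<Rightarrow> tile) \<Rightarrow> int \<times> int \<Rightarrow> tile" where
  "affine_tile k n lam D = (\<lambda>(x, y).
     if \<exists>m :: int. (x - m * (int n - int k), y + m * int k) \<in> pipe_shape k n lam \<and>
                   D (x - m * (int n - int k), y + m * int k) = Elbow
     then Elbow else Cross)"

text \<open>\<open>HEdge (x, y)\<close> is the unit edge from \<open>(x, y)\<close> to \<open>(x + 1, y)\<close>, and \<open>VEdge (x, y)\<close> the one
  from \<open>(x, y)\<close> to \<open>(x, y + 1)\<close>: the South and the West edge of the cell \<open>(x, y)\<close>.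
  Hence both are the edges through which a pipe travelling north or east enters that cell.\<close>

datatype edge = HEdge "int \<times> int" | VEdge "int \<times> int"

fun next_edge :: "(int \<times> int \<Rightarrow> tile) \<Rightarrow> edge \<Rightarrow> edge" where
  "next_edge T (HEdge (x, y)) =
     (case T (x, y) of Cross \<Rightarrow> HEdge (x, y + 1) | Elbow \<Rightarrow> VEdge (x + 1, y))"
| "next_edge T (VEdge (x, y)) =
     (case T (x, y) of Cross \<Rightarrow> VEdge (x + 1, y) | Elbow \<Rightarrow> HEdge (x, y + 1))"

text \<open>Step \<^term>\<open>i\<close> of the path moved up by \<^term>\<open>h\<close>.  A South step ends in its lower end point,
  an East step starts in its left one.\<close>

definition step_edge :: "nat \<Rightarrow> int set \<Rightarrow> int \<Rightarrow> int \<Rightarrow> edge" where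
  "step_edge n lam h i =
     (if is_south n lam i
      then VEdge (fst (path_vertex n lam i), snd (path_vertex n lam i) + h)
      else HEdge (fst (path_vertex n lam (i - 1)), snd (path_vertex n lam (i - 1)) + h))"

abbreviation lower_edge :: "nat \<Rightarrow> int set \<Rightarrow> int \<Rightarrow> edge" where
  "lower_edge n lam \<equiv> step_edge n lam 0"

abbreviation upper_edge :: "nat \<Rightarrow> nat \<Rightarrow> int set \<Rightarrow> int \<Rightarrow> edge" where
  "upper_edge k n lam \<equiv> step_edge n lam (int k)"

definition pipe_edge ::
  "nat \<Rightarrow> nat \<Rightarrow> int set \<Rightarrow> (int \<times> int \<Rightarrow> tile) \<Rightarrow> int \<Rightarrow> nat \<Rightarrow> edge" where
  "pipe_edge k n lam D i t = (next_edge (affine_tile k n lam D) ^^ t) (lower_edge n lam i)"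

text \<open>The pipe leaves the strip when it meets the upper boundary for the first time.  This may
  happen at once: for \<^prop>\<open>k = (0::nat)\<close> and for \<^prop>\<open>k = (n::nat)\<close> the strip has no cells.\<close>

definition pipe_dream_perm ::
  "nat \<Rightarrow> nat \<Rightarrow> int set \<Rightarrow> (int \<times> int \<Rightarrow> tile) \<Rightarrow> int \<Rightarrow> int" where
  "pipe_dream_perm k n lam D i =
     (THE j. \<exists>t. pipe_edge k n lam D i t = upper_edge k n lam j \<and>
                 (\<forall>s<t. pipe_edge k n lam D i s \<notin> range (upper_edge k n lam)))"


section \<open>Positroid varieties\<close>

definition column :: "nat \<Rightarrow> complex mat \<Rightarrow> int \<Rightarrow> complex vec" where
  "column n M a = col M (nat ((a - 1) mod int n))"

text \<open>The points of the Grassmannian are represented by full-rank matrices; the following set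
  consists of all representatives of the points of the positroid variety.\<close>

definition positroid_variety :: "nat \<Rightarrow> nat \<Rightarrow> (int \<Rightarrow> int) \<Rightarrow> complex mat set" where
  "positroid_variety k n g =
     {M \<in> carrier_mat k n. vec_space.rank k M = k \<and>
        (\<forall>i j. i \<le> j \<and> j \<le> i + int n \<longrightarrow>
           int (vec_space.rank k (mat_of_cols k (map (column n M) [i..j])))
             \<le> (j - i + 1) - int (card {a. i \<le> a \<and> g a \<le> j}))}"

definition maximal_minor :: "nat \<Rightarrow> nat \<Rightarrow> int set \<Rightarrow> complex mat \<Rightarrow> complex" where
  "maximal_minor k n I M = det (mat_of_cols k (map (column n M) (sorted_list_of_set I)))"

inductive_set entry_polynomials :: "nat \<Rightarrow> nat \<Rightarrow> (complex mat \<Rightarrow> complex) set" for k n where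
  const: "(\<lambda>M. c) \<in> entry_polynomials k n"
| entry: "r < k \<Longrightarrow> s < n \<Longrightarrow> (\<lambda>M. M $$ (r, s)) \<in> entry_polynomials k n"
| add: "p \<in> entry_polynomials k n \<Longrightarrow> q \<in> entry_polynomials k n \<Longrightarrow>
          (\<lambda>M. p M + q M) \<in> entry_polynomials k n"
| mult: "p \<in> entry_polynomials k n \<Longrightarrow> q \<in> entry_polynomials k n \<Longrightarrow>
          (\<lambda>M. p M * q M) \<in> entry_polynomials k n"

definition zariski_closed :: "nat \<Rightarrow> nat \<Rightarrow> complex mat set \<Rightarrow> bool" where
  "zariski_closed k n Z \<longleftrightarrow>
     (\<exists>F \<subseteq> entry_polynomials k n. Z = {M \<in> carrier_mat k n. \<forall>p\<in>F. p M = 0})"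

text \<open>\<^term>\<open>P\<close> holds for a generic point of \<^term>\<open>X\<close> iff it holds on a nonempty Zariski open
  subset of \<^term>\<open>X\<close>.  This is the usual notion for irreducible \<^term>\<open>X\<close>, where such a subset is
  automatically dense; positroid varieties are irreducible (Knutson, Lam and Speyer).  The set
  of matrix representatives is saturated under row operations, and the map to the Grassmannian is
  open, so testing genericity on the representatives amounts to testing it on the variety.\<close>

definition generically ::
  "nat \<Rightarrow> nat \<Rightarrow> complex mat set \<Rightarrow> (complex mat \<Rightarrow> bool) \<Rightarrow> bool" where
  "generically k n X P \<longleftrightarrow>
     (\<exists>Z. zariski_closed k n Z \<and> X - Z \<noteq> {} \<and> (\<forall>M \<in> X - Z. P M))"

definition gale_le :: "int set \<Rightarrow> int set \<Rightarrow> bool" where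
  "gale_le I J \<longleftrightarrow> list_all2 (\<le>) (sorted_list_of_set I) (sorted_list_of_set J)"

definition generic_bases :: "nat \<Rightarrow> nat \<Rightarrow> (int \<Rightarrow> int) \<Rightarrow> int set set" where
  "generic_bases k n g =
     {I. I \<subseteq> {1..int n} \<and> card I = k \<and>
         generically k n (positroid_variety k n g) (\<lambda>M. maximal_minor k n I M \<noteq> 0)}"

definition first_necklace :: "nat \<Rightarrow> nat \<Rightarrow> (int \<Rightarrow> int) \<Rightarrow> int set" where
  "first_necklace k n g =
     (THE I. I \<in> generic_bases k n g \<and> (\<forall>J \<in> generic_bases k n g. gale_le I J))"

text \<open>The combinatorial description of the same set.\<close>

definition first_necklace_comb :: "nat \<Rightarrow> (int \<Rightarrow> int) \<Rightarrow> int set" where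
  "first_necklace_comb n g = {j \<in> {1..int n}. inv_into UNIV g j \<le> 0}"

end

theory Submission
  imports Defs
begin

text \<open>
  Write \<open>x\<^sub>i, y\<^sub>i\<close> for the coordinates of the vertex of the path after step \<open>i\<close>, so that
  \<open>x\<^sub>j - x\<^sub>i\<close> and \<open>y\<^sub>i - y\<^sub>j\<close> count the East and the South steps among \<open>i + 1, \<dots>, j\<close>.

  \<^emph>\<open>The pipes.\<close>  A tile turns the edge through which a pipe enters a cell into one through which it
  leaves, so the cell in front of the old edge is the cell behind the new one.  The lower boundary
  consists of the edges with the cell in front, but not the one behind, weakly above the path;
  likewise for the upper boundary and the raised path.  As being above the path is preserved by
  going north and east, each pipe meets either boundary exactly once, distinct pipes share no
  edge, and, tracing backwards, every upper step is reached.  Hence \<open>g\<close> is a bijection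
  (\<open>exit_step_inj\<close>, \<open>exit_step_surj\<close>).

  \<^emph>\<open>The combinatorial necklace.\<close>  In the columns \<open>0 \<le> x < n - k\<close> there are no elbows at height
  \<open>y \<ge> 0\<close>.  A pipe that starts at a step \<open>\<le> 0\<close> is never below height \<open>0\<close>, and hence cannot turn
  north in these columns, whereas one that starts at a step \<open>\<ge> 1\<close> cannot turn east in their part of
  nonnegative height.  So the pipes that leave through the steps \<open>1, \<dots>, n\<close> come from steps \<open>\<le> 0\<close>
  exactly where the step is South, that is, in \<open>\<lambda>\<close>.

  \<^emph>\<open>The geometric necklace.\<close>  A minor is generically nonzero on the positroid variety iff it
  is nonzero at one point.  If the columns indexed by \<open>J\<close> are independent at a point of the variety,
  the rank condition for the columns \<open>1, \<dots>, j\<close> shows that \<open>J\<close> has at most as many elements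
  up to \<open>j\<close> as \<open>\<lambda>\<close>, which means that \<open>\<lambda>\<close> is below \<open>J\<close> in Gale order.  It remains to see that \<open>\<lambda>\<close>
  itself is a basis somewhere on the variety.  This happens at the coordinate subspace spanned by the
  unit vectors indexed by \<open>\<lambda>\<close>, and its rank conditions amount to
  \<open>#{a \<ge> i. g a \<le> j} \<le> #{East steps in [i, j]}\<close> (\<open>card_exits_le_east\<close>): when at most \<open>k\<close> of the
  steps from \<open>i\<close> to \<open>j\<close> are South, all the pipes on the left cross the horizontal line through the
  start of step \<open>i\<close> from below to above, between \<open>x\<^bsub>i-1\<^esub>\<close> and \<open>x\<^sub>j\<close>, and there is only room for
  \<open>x\<^sub>j - x\<^bsub>i-1\<^esub>\<close> of them.  More than \<open>k\<close> South steps occur only when \<open>j = i + n\<close>, where the condition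
  follows from the one for \<open>j - 1\<close>.
\<close>

section \<open>Vertices of the bi-infinite path\<close>

lemma card_Collect_insert:
  assumes "finite A" "b \<notin> A"
  shows "card {a \<in> insert b A. P a} = card {a \<in> A. P a} + (if P b then 1 else 0)"
proof -
  have "{a \<in> insert b A. P a} = (if P b then insert b {a \<in> A. P a} else {a \<in> A. P a})" by auto
  moreover have "finite {a \<in> A. P a}" using assms by simp
  ultimately show ?thesis using assms by auto
qed

lemma signed_count_step:
  "signed_count P i = signed_count P (i - 1) + (if P i then 1 else 0)"
proof (cases "1 \<le> i")
  case True
  then have "{1..i} = insert i {1..i - 1}" "{i..0} = {}" "{i + 1..0} = {}" by auto
  then show ?thesis
    using card_Collect_insert[of "{1..i - 1}" i P] unfolding signed_count_def by simp
next
  case False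
  then have "{i..0} = insert i {i + 1..0}" "{1..i} = {}" "{1..i - 1} = {}" by auto
  then show ?thesis
    using card_Collect_insert[of "{i + 1..0}" i P] unfolding signed_count_def by simp
qed

lemma card_interval_eq_signed_count:
  assumes "i - 1 \<le> j"
  shows "int (card {a \<in> {i..j}. P a}) = signed_count P j - signed_count P (i - 1)"
  using assms
proof (induction j rule: int_ge_induct)
  case base
  then show ?case by simp
next
  case (step j)
  then have "{i..j + 1} = insert (j + 1) {i..j}" by auto
  then show ?case
    using step.IH signed_count_step[of P "j + 1"] card_Collect_insert[of "{i..j}" "j + 1" P]
    by simp
qed

lemma signed_count_mono: "i \<le> j \<Longrightarrow> signed_count P i \<le> signed_count P j"
  using card_interval_eq_signed_count[of "i + 1" j P] by simp

lemma signed_count_total: "signed_count P i + signed_count (\<lambda>a. \<not> P a) i = i"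
proof (induction i rule: int_induct[where k = 0])
  case base
  then show ?case by (simp add: signed_count_def)
next
  case (step1 i)
  then show ?case
    using signed_count_step[of P "i + 1"] signed_count_step[of "\<lambda>a. \<not> P a" "i + 1"]
    by (cases "P (i + 1)") auto
next
  case (step2 i)
  then show ?case
    using signed_count_step[of P i] signed_count_step[of "\<lambda>a. \<not> P a" i] by (cases "P i") auto
qed

section \<open>Tiles as maps between edges\<close>

text \<open>The cell that a pipe enters through an edge, and the cell that it has left through it.\<close>

fun front :: "edge \<Rightarrow> int \<times> int" where
  "front (HEdge c) = c"
| "front (VEdge c) = c"

fun behind :: "edge \<Rightarrow> int \<times> int" where
  "behind (HEdge (x, y)) = (x, y - 1)"
| "behind (VEdge (x, y)) = (x - 1, y)"

lemma edge_cases [case_names H V]: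
  obtains x y where "e = HEdge (x, y)" | x y where "e = VEdge (x, y)"
  by (cases e) auto

text \<open>This makes a pipe a walk whose consecutive edges share a cell.  As a tile matches the two
  entrances of its cell with the two exits, the walk can also be traced backwards in a unique way.\<close>

lemma behind_next_edge [simp]: "behind (next_edge T e) = front e"
  by (cases e rule: edge_cases) (auto split: tile.split)

lemma next_edge_inj: "inj (next_edge T)"
proof (rule injI)
  fix e e' assume eq: "next_edge T e = next_edge T e'"
  then have "front e = front e'" by (metis behind_next_edge)
  with eq show "e = e'"
    by (cases e rule: edge_cases; cases e' rule: edge_cases) (auto split: tile.splits)
qed

lemma next_edge_preimage: obtains e' where "next_edge T e' = e" "front e' = behind e"
proof -
  obtain x y where c: "behind e = (x, y)" by (cases "behind e")
  have "next_edge T (HEdge (x, y)) = e \<or> next_edge T (VEdge (x, y)) = e"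
    using c by (cases e rule: edge_cases; cases "T (x, y)") auto
  then show thesis using that c by (metis front.simps)
qed

lemma front_next_edge:
  "front (next_edge T e) = (fst (front e) + 1, snd (front e)) \<or>
   front (next_edge T e) = (fst (front e), snd (front e) + 1)"
  by (cases e rule: edge_cases) (auto split: tile.split)

lemma behind_eq_front:
  "behind e = (fst (front e) - 1, snd (front e)) \<or> behind e = (fst (front e), snd (front e) - 1)"
  by (cases e rule: edge_cases) auto

section \<open>The strip between the path and its translate\<close>

locale distinguished_path =
  fixes n k :: nat and lam :: "int set"
  assumes lam_subset: "lam \<subseteq> {1..int n}" and card_lam: "card lam = k"
begin

abbreviation "south \<equiv> is_south n lam"
abbreviation "vx i \<equiv> fst (path_vertex n lam i)"
abbreviation "vy i \<equiv> snd (path_vertex n lam i)"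

lemma vx_step: "vx i = vx (i - 1) + (if south i then 0 else 1)"
  using signed_count_step[of "\<lambda>a. \<not> south a" i] by (simp add: path_vertex_def)

lemma vy_step: "vy i = vy (i - 1) - (if south i then 1 else 0)"
  using signed_count_step[of south i] by (simp add: path_vertex_def)

lemma vx_0 [simp]: "vx 0 = 0" and vy_0 [simp]: "vy 0 = 0"
  by (simp_all add: path_vertex_def signed_count_def)

lemma vx_mono: "i \<le> j \<Longrightarrow> vx i \<le> vx j"
  by (simp add: path_vertex_def signed_count_mono)

lemma vy_antimono: "i \<le> j \<Longrightarrow> vy j \<le> vy i"
  by (simp add: path_vertex_def signed_count_mono)

lemma vx_minus_vy: "vx i - vy i = i"
  using signed_count_total[of south i] by (simp add: path_vertex_def)

lemma card_south: "i - 1 \<le> j \<Longrightarrow> int (card {a \<in> {i..j}. south a}) = vy (i - 1) - vy j"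
  unfolding path_vertex_def using card_interval_eq_signed_count by simp

lemma card_east: "i - 1 \<le> j \<Longrightarrow> int (card {a \<in> {i..j}. \<not> south a}) = vx j - vx (i - 1)"
  unfolding path_vertex_def using card_interval_eq_signed_count by simp

lemma south_iff: "i \<in> {1..int n} \<Longrightarrow> south i \<longleftrightarrow> i \<in> lam"
  by (auto simp: is_south_def)

lemma south_periodic: "south (i + int n) \<longleftrightarrow> south i"
proof -
  have "i + int n - 1 = (i - 1) + int n" by simp
  then show ?thesis unfolding is_south_def by (metis mod_add_self2)
qed

lemma south_window: "vy (i + int n) = vy i - int k"
proof (induction i rule: int_induct[where k = 0])
  case base
  have "{a \<in> {1..int n}. south a} = lam" using lam_subset south_iff by auto
  then show ?case using card_south[of 1 "int n"] card_lam by simp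
next
  case (step1 i)
  then show ?case
    using vy_step[of "i + 1"] vy_step[of "i + 1 + int n"] south_periodic[of "i + 1"]
    by (simp add: algebra_simps)
next
  case (step2 i)
  then show ?case
    using vy_step[of i] vy_step[of "i + int n"] south_periodic[of i] by (simp add: algebra_simps)
qed

lemma east_window: "vx (i + int n) = vx i + int n - int k"
  using south_window[of i] vx_minus_vy[of "i + int n"] vx_minus_vy[of i] by simp

lemma k_le_n: "k \<le> n"
  using card_mono[OF _ lam_subset] card_lam by simp

text \<open>Describing a step by its two adjacent cells, rather than by its shape, removes the
  distinction between South and East steps.\<close>

lemma front_step_edge: "front (step_edge n lam h i) = (vx (i - 1), vy i + h)"
  using vx_step[of i] vy_step[of i] by (simp add: step_edge_def)

lemma behind_step_edge: "behind (step_edge n lam h i) = (vx i - 1, vy (i - 1) - 1 + h)"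
  using vx_step[of i] vy_step[of i] by (simp add: step_edge_def)

text \<open>The points above the path raised by \<open>h\<close>, described as those northeast of one of its vertices:
  then going north or east stays in the region by definition.\<close>

definition above :: "int \<Rightarrow> (int \<times> int) set" where
  "above h = {(x, y). \<exists>i. vx i \<le> x \<and> vy i + h \<le> y}"

lemma above_upward: "(x, y) \<in> above h \<Longrightarrow> x \<le> x' \<Longrightarrow> y \<le> y' \<Longrightarrow> (x', y') \<in> above h"
  unfolding above_def by (auto intro: order_trans)

lemma above_antimono: "h \<le> h' \<Longrightarrow> above h' \<subseteq> above h"
  unfolding above_def by force

lemma step_edge_boundary:
  "front (step_edge n lam h i) \<in> above h" "behind (step_edge n lam h i) \<notin> above h"
proof -
  show "front (step_edge n lam h i) \<in> above h"
    unfolding front_step_edge above_def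
    using vx_step[of i] vy_step[of i] by (cases "south i") (auto intro: exI[of _ i] exI[of _ "i - 1"])
  show "behind (step_edge n lam h i) \<notin> above h"
  proof
    assume "behind (step_edge n lam h i) \<in> above h"
    then obtain j where j: "vx j \<le> vx i - 1" "vy j \<le> vy (i - 1) - 1"
      unfolding behind_step_edge above_def by auto
    show False using j vx_mono[of i j] vy_antimono[of j "i - 1"] by linarith
  qed
qed

text \<open>A horizontal boundary edge begins at the last vertex of the path with the abscissa of its left end,
  and the lower end of a vertical one is the first vertex with that ordinate.  These vertices exist even if the path has no East or no
  South steps: on the part of the path southwest of the edge one coordinate is forced, and
  \<open>x\<^sub>i - y\<^sub>i = i\<close> then bounds the index.\<close>

lemma boundary_step_edge:
  assumes "front e \<in> above h" "behind e \<notin> above h"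
  shows "\<exists>i. e = step_edge n lam h i"
proof (cases e rule: edge_cases)
  case (H x y)
  obtain j where j: "vx j \<le> x" "vy j + h \<le> y"
    using assms(1) H by (auto simp: above_def)
  have no: "y - 1 < vy i + h" if "vx i \<le> x" for i
    using assms(2) H that by (force simp: above_def)
  have far: "i \<le> x - y + h" if "j \<le> i" "vx i \<le> x" for i
    using no[OF that(2)] vy_antimono[OF that(1)] j vx_minus_vy[of i] that by linarith
  define S where "S = {i. j \<le> i \<and> vx i \<le> x}"
  have S: "finite S" "j \<in> S" using far j
    by (auto simp: S_def intro: finite_subset[of _ "{j..x - y + h}"])
  define i where "i = Max S"
  have iS: "i \<in> S" unfolding i_def using S by (intro Max_in) auto
  have "i + 1 \<notin> S" unfolding i_def using S Max_ge[of S "Max S + 1"] by auto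
  with iS have i: "j \<le> i" "vx i \<le> x" "x < vx (i + 1)" by (auto simp: S_def)
  then have e: "\<not> south (i + 1)" "vx i = x" using vx_step[of "i + 1"] by (auto split: if_splits)
  have "vy i + h = y" using no[OF i(2)] vy_antimono[OF i(1)] j by linarith
  then show ?thesis using e H by (intro exI[of _ "i + 1"]) (simp add: step_edge_def)
next
  case (V x y)
  obtain j where j: "vx j \<le> x" "vy j + h \<le> y"
    using assms(1) V by (auto simp: above_def)
  have no: "x - 1 < vx i" if "vy i + h \<le> y" for i
    using assms(2) V that by (force simp: above_def)
  have far: "x - y + h \<le> i" if "i \<le> j" "vy i + h \<le> y" for i
    using no[OF that(2)] vx_mono[OF that(1)] j vx_minus_vy[of i] that by linarith
  define S where "S = {i. i \<le> j \<and> vy i + h \<le> y}"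
  have S: "finite S" "j \<in> S" using far j
    by (auto simp: S_def intro: finite_subset[of _ "{x - y + h..j}"])
  define i where "i = Min S"
  have iS: "i \<in> S" unfolding i_def using S by (intro Min_in) auto
  have "i - 1 \<notin> S" unfolding i_def using S Min_le[of S "Min S - 1"] by auto
  with iS have i: "i \<le> j" "vy i + h \<le> y" "y < vy (i - 1) + h" by (auto simp: S_def)
  then have e: "south i" "vy i + h = y" using vy_step[of i] by (auto split: if_splits)
  have "vx i = x" using no[OF i(2)] vx_mono[OF i(1)] j by linarith
  then show ?thesis using e V by (intro exI[of _ i]) (simp add: step_edge_def)
qed

lemma step_edge_inj: "step_edge n lam h i = step_edge n lam h j \<Longrightarrow> i = j"
proof -
  assume eq: "step_edge n lam h i = step_edge n lam h j"
  have "vx (i - 1) = vx (j - 1)" "vy (i - 1) = vy (j - 1)"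
    using arg_cong[OF eq, of front] arg_cong[OF eq, of behind]
    by (simp_all add: front_step_edge behind_step_edge)
  then show "i = j" using vx_minus_vy[of "i - 1"] vx_minus_vy[of "j - 1"] by linarith
qed

end

section \<open>Pipes in the strip\<close>

locale pipe_strip = distinguished_path +
  fixes T :: "int \<times> int \<Rightarrow> tile"
begin

lemma front_funpow:
  "fst (front e) \<le> fst (front ((next_edge T ^^ t) e))"
  "snd (front e) \<le> snd (front ((next_edge T ^^ t) e))"
  "fst (front ((next_edge T ^^ t) e)) + snd (front ((next_edge T ^^ t) e)) =
     fst (front e) + snd (front e) + int t"
proof (induction t)
  case (Suc t)
  { case 1 then show ?case using Suc front_next_edge[of T "(next_edge T ^^ t) e"] by auto next
    case 2 then show ?case using Suc front_next_edge[of T "(next_edge T ^^ t) e"] by auto next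
    case 3 then show ?case using Suc front_next_edge[of T "(next_edge T ^^ t) e"] by auto }
qed simp_all

text \<open>The strip has height \<open>k\<close> and width \<open>n - k\<close>, and among \<open>n\<close> moves there are at least \<open>k\<close> going north
  or at least \<open>n - k\<close> going east.\<close>

lemma crosses_strip:
  assumes "front e \<in> above 0"
  shows "front ((next_edge T ^^ n) e) \<in> above (int k)"
proof -
  obtain i where i: "vx i \<le> fst (front e)" "vy i \<le> snd (front e)"
    using assms by (auto simp: above_def case_prod_unfold)
  let ?c = "front ((next_edge T ^^ n) e)"
  note m = front_funpow[where t = n and e = e]
  consider "snd (front e) + int k \<le> snd ?c" | "fst (front e) + (int n - int k) \<le> fst ?c"
    using m(3) by linarith
  then have "\<exists>i. vx i \<le> fst ?c \<and> vy i + int k \<le> snd ?c"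
  proof cases
    case 1
    then show ?thesis using i m by (intro exI[of _ i]) linarith
  next
    case 2
    then show ?thesis using i m south_window[of i] east_window[of i]
      by (intro exI[of _ "i + int n"]) linarith
  qed
  then show ?thesis by (simp add: above_def case_prod_unfold)
qed

lemma front_next_edge_above: "front e \<in> above h \<Longrightarrow> front (next_edge T e) \<in> above h"
  using front_next_edge[of T e] above_upward[of "fst (front e)" "snd (front e)" h]
  by (metis add_increasing2 order_refl prod.collapse zero_le_one)

abbreviation pipe :: "int \<Rightarrow> nat \<Rightarrow> edge" where
  "pipe i t \<equiv> (next_edge T ^^ t) (lower_edge n lam i)"

lemma front_above_funpow: "front e \<in> above h \<Longrightarrow> front ((next_edge T ^^ t) e) \<in> above h"
  by (induction t) (auto intro: front_next_edge_above)

lemma pipe_above: "front (pipe i t) \<in> above 0"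
  by (rule front_above_funpow[OF step_edge_boundary(1)])

text \<open>The first time that the cell in front of the pipe is above the raised path, the cell
  behind it is not: it was in front one move earlier, or it is below the lower boundary.  So the pipe is on
  the upper boundary.\<close>

lemma pipe_meets_upper: "\<exists>t j. pipe i t = upper_edge k n lam j"
proof -
  define t where "t = (LEAST t. front (pipe i t) \<in> above (int k))"
  have t: "front (pipe i t) \<in> above (int k)"
    unfolding t_def using crosses_strip[OF step_edge_boundary(1)] by (rule LeastI)
  have "behind (pipe i t) \<notin> above (int k)"
  proof (cases t)
    case 0
    then show ?thesis using step_edge_boundary(2)[of 0 i] above_antimono[of 0 "int k"] by auto
  next
    case (Suc s)
    then have "front (pipe i s) \<notin> above (int k)"
      using not_less_Least[of s "\<lambda>t. front (pipe i t) \<in> above (int k)"] unfolding t_def by auto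
    then show ?thesis using Suc by simp
  qed
  with t show ?thesis using boundary_step_edge by blast
qed

text \<open>Once on the upper boundary, a pipe only sees cells above the raised path.  Hence the exit step is
  characterised without reference to the first meeting with the boundary.\<close>

lemma pipe_meets_upper_once:
  assumes "pipe i s = upper_edge k n lam j" "pipe i t = upper_edge k n lam l"
  shows "s = t"
proof -
  have False if "s < t" "pipe i s = upper_edge k n lam j" "pipe i t = upper_edge k n lam l" for s t j l
  proof -
    obtain d where d: "t = Suc (d + s)" using \<open>s < t\<close> less_iff_Suc_add by (metis add.commute)
    have "front (pipe i s) \<in> above (int k)" using that step_edge_boundary by metis
    then have "front (pipe i (d + s)) \<in> above (int k)"
      using front_above_funpow[of "pipe i s" "int k" d] by (simp add: funpow_add)
    then have "behind (pipe i t) \<in> above (int k)" using d by simp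
    then show False using that step_edge_boundary by metis
  qed
  then show ?thesis using assms by (metis linorder_neqE_nat)
qed

definition exit_step :: "int \<Rightarrow> int" where
  "exit_step i =
     (THE j. \<exists>t. pipe i t = upper_edge k n lam j \<and> (\<forall>s<t. pipe i s \<notin> range (upper_edge k n lam)))"

lemma exit_step_eq_iff: "exit_step i = j \<longleftrightarrow> (\<exists>t. pipe i t = upper_edge k n lam j)"
proof -
  obtain t l where l: "pipe i t = upper_edge k n lam l" using pipe_meets_upper by blast
  have "exit_step i = l"
    unfolding exit_step_def
  proof (rule the_equality)
    show "\<exists>t. pipe i t = upper_edge k n lam l \<and> (\<forall>s<t. pipe i s \<notin> range (upper_edge k n lam))"
      using l pipe_meets_upper_once by (metis nat_neq_iff rangeE)
  next
    fix j assume "\<exists>t. pipe i t = upper_edge k n lam j \<and> (\<forall>s<t. pipe i s \<notin> range (upper_edge k n lam))"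
    then show "j = l" using l pipe_meets_upper_once step_edge_inj by metis
  qed
  then show ?thesis using l pipe_meets_upper_once step_edge_inj by metis
qed

text \<open>If two pipes share an edge, then tracing both of them backwards shows that one of them starts on the
  other.  But after its first edge a pipe always has a cell above the path behind it, so it does
  not return to the lower boundary.\<close>

lemma pipes_disjoint:
  assumes "pipe a s = pipe b t"
  shows "a = b"
proof -
  have *: "a = b" if "s \<le> t" "pipe a s = pipe b t" for a b :: int and s t
  proof -
    obtain d where d: "t = s + d" using \<open>s \<le> t\<close> le_Suc_ex by blast
    have "inj (next_edge T ^^ s)" using next_edge_inj by (rule inj_fn)
    then have eq: "lower_edge n lam a = pipe b d"
      using that(2) d by (simp add: funpow_add inj_eq)
    show "a = b"
    proof (cases d)
      case 0
      then show ?thesis using eq step_edge_inj by simp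
    next
      case (Suc d')
      then have "behind (lower_edge n lam a) = front (pipe b d')" using eq by simp
      then show ?thesis using pipe_above[of d' b] step_edge_boundary(2)[of 0 a] by simp
    qed
  qed
  show ?thesis using *[of s t a b] *[of t s b a] assms by (metis nat_le_linear)
qed

lemma exit_step_inj: "inj exit_step"
  by (rule injI) (metis exit_step_eq_iff pipes_disjoint)

text \<open>Tracing backwards from an upper step can only end on the lower boundary, and it has to end,
  since a walk of \<open>n\<close> moves inside the region above the path crosses the strip.\<close>

lemma exit_step_surj: "surj exit_step"
proof -
  have "\<exists>a t. pipe a t = upper_edge k n lam j" for j
  proof (rule ccontr)
    assume none: "\<not> ?thesis"
    \<comment> \<open>Without a start on the lower boundary, the walk extends backwards indefinitely.\<close>
    have "\<exists>e. (next_edge T ^^ m) e = upper_edge k n lam j \<and> front e \<in> above 0" for m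
    proof (induction m)
      case 0
      then show ?case using step_edge_boundary(1)[of "int k" j] above_antimono[of 0 "int k"] by auto
    next
      case (Suc m)
      then obtain e where e: "(next_edge T ^^ m) e = upper_edge k n lam j" "front e \<in> above 0" by auto
      have "behind e \<in> above 0"
        using none e boundary_step_edge by blast
      moreover obtain e' where "next_edge T e' = e" "front e' = behind e"
        using next_edge_preimage .
      ultimately show ?case using e(1) by (intro exI[of _ e']) (simp add: funpow_swap1)
    qed
    \<comment> \<open>After \<open>n\<close> of \<open>n + 1\<close> moves the walk is above the raised path, so its end is past the boundary.\<close>
    from this[of "Suc n"] obtain e where e: "next_edge T ((next_edge T ^^ n) e) = upper_edge k n lam j"
      "front e \<in> above 0" by auto
    then have "behind (upper_edge k n lam j) \<in> above (int k)"
      using crosses_strip[OF e(2)] by (metis behind_next_edge)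
    then show False using step_edge_boundary by blast
  qed
  then show ?thesis by (metis exit_step_eq_iff surjI)
qed

section \<open>Counting the pipes between two windows of steps\<close>

lemma behind_funpow_fst: "fst (behind e) \<le> fst (behind ((next_edge T ^^ t) e))"
proof (induction t)
  case (Suc t)
  then show ?case using behind_eq_front[of "(next_edge T ^^ t) e"] by auto
qed simp

text \<open>Heights are compared with the cell behind the first edge and the cell in front of the last one, so
  that a pipe which starts or ends on the line \<open>y = h\<close> counts as crossing it.\<close>

lemma crosses_height:
  assumes "snd (behind e) < h" "h \<le> snd (front ((next_edge T ^^ t) e))"
  shows "\<exists>s\<le>t. \<exists>x. (next_edge T ^^ s) e = HEdge (x, h)"
proof -
  define s where "s = (LEAST s. h \<le> snd (front ((next_edge T ^^ s) e)))"
  have s: "h \<le> snd (front ((next_edge T ^^ s) e))" unfolding s_def using assms(2) by (rule LeastI)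
  have le: "s \<le> t" unfolding s_def using assms(2) by (rule Least_le)
  have "snd (behind ((next_edge T ^^ s) e)) < h"
  proof (cases s)
    case 0
    then show ?thesis using assms by simp
  next
    case (Suc r)
    then have "\<not> h \<le> snd (front ((next_edge T ^^ r) e))"
      using not_less_Least[of r "\<lambda>s. h \<le> snd (front ((next_edge T ^^ s) e))"] unfolding s_def by auto
    then show ?thesis using Suc by simp
  qed
  with s have "\<exists>x. (next_edge T ^^ s) e = HEdge (x, h)"
    by (cases "(next_edge T ^^ s) e" rule: edge_cases) auto
  with le show ?thesis by blast
qed

text \<open>Each of these pipes starts at or below the vertex before step \<open>i\<close> and, by the assumption, ends at
  or above its height.  So it contains a horizontal edge at that height, lying in one of the columns
  between the start of step \<open>i\<close> and the end of step \<open>j\<close>, and different pipes use different columns.\<close>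

lemma card_exits_le_east:
  assumes "vy (i - 1) - vy j \<le> int k"
  shows "finite {a. i \<le> a \<and> exit_step a \<le> j}"
    and "int (card {a. i \<le> a \<and> exit_step a \<le> j}) \<le> max 0 (vx j - vx (i - 1))"
proof -
  let ?A = "{a. i \<le> a \<and> exit_step a \<le> j}" and ?h = "vy (i - 1)"
  have "\<exists>x\<in>{vx (i - 1)..<vx j}. \<exists>s. pipe a s = HEdge (x, ?h)" if "a \<in> ?A" for a
  proof -
    define b where "b = exit_step a"
    obtain t where "pipe a t = upper_edge k n lam b" using exit_step_eq_iff b_def by metis
    then have b: "pipe a t = upper_edge k n lam b" "i \<le> a" "b \<le> j" using that b_def by auto
    have "snd (behind (lower_edge n lam a)) < ?h"
      using vy_antimono[of "i - 1" "a - 1"] b by (simp add: behind_step_edge)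
    moreover have "?h \<le> snd (front (pipe a t))"
      using vy_antimono[of b j] b assms by (simp add: front_step_edge)
    ultimately obtain s x where s: "s \<le> t" "pipe a s = HEdge (x, ?h)" using crosses_height by blast
    have "vx (i - 1) \<le> x"
      using front_funpow(1)[where e = "lower_edge n lam a" and t = s] s vx_mono[of "i - 1" "a - 1"] b
      by (simp add: front_step_edge)
    moreover have "(next_edge T ^^ (t - s)) (pipe a s) = pipe a t"
      using s(1) funpow_add[of "t - s" s "next_edge T"] by simp
    then have "x < vx j"
      using behind_funpow_fst[of "pipe a s" "t - s"] s vx_mono[of b j] b
      by (simp add: behind_step_edge)
    ultimately show ?thesis using s by auto
  qed
  then obtain c where c: "\<And>a. a \<in> ?A \<Longrightarrow> c a \<in> {vx (i - 1)..<vx j} \<and> (\<exists>s. pipe a s = HEdge (c a, ?h))"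
    by metis
  have "inj_on c ?A"
  proof (rule inj_onI)
    fix a b assume ab: "a \<in> ?A" "b \<in> ?A" "c a = c b"
    obtain s where "pipe a s = HEdge (c a, ?h)" using c[OF ab(1)] by blast
    moreover obtain t where "pipe b t = HEdge (c b, ?h)" using c[OF ab(2)] by blast
    ultimately show "a = b" using ab(3) pipes_disjoint[of s a t b] by simp
  qed
  moreover have "c ` ?A \<subseteq> {vx (i - 1)..<vx j}" using c by blast
  ultimately show "finite ?A" and "int (card ?A) \<le> max 0 (vx j - vx (i - 1))"
    using card_inj_on_le[of c ?A "{vx (i - 1)..<vx j}"] by (auto intro: inj_on_finite)
qed

end

section \<open>Exits of the pipes that start before or after the origin\<close>

text \<open>All that the exits of the pipes through the steps \<open>1, \<dots>, n\<close> require of an affine pipe dream.\<close>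

locale confined_strip = pipe_strip +
  assumes elbow: "T (x, y) = Elbow \<Longrightarrow> x < 0 \<or> int n - int k \<le> x \<or> y < 0"
begin

text \<open>The invariant: the pipe stays in \<open>x \<ge> 0\<close>, so that turning east needs an elbow below height
  \<open>0\<close> or beyond the columns \<open>0 \<le> x < n - k\<close>.  The South steps of the upper boundary among \<open>1, \<dots>, n\<close>
  are vertical edges at height at least \<open>0\<close> and with \<open>x \<le> n - k\<close>.\<close>

lemma exit_of_late_pipe:
  assumes "1 \<le> a" "exit_step a \<in> {1..int n}"
  shows "\<not> south (exit_step a)"
proof
  let ?b = "exit_step a"
  assume south: "south ?b"
  obtain t where t: "pipe a t = upper_edge k n lam ?b" using exit_step_eq_iff by blast
  have "0 \<le> fst (front (pipe a s)) \<and>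
      (\<forall>x y. pipe a s = VEdge (x, y) \<longrightarrow> y < 0 \<or> int n - int k < x)" for s
  proof (induction s)
    case 0
    show ?case
      using vx_mono[of 0 "a - 1"] vy_antimono[of 0 "a - 1"] \<open>1 \<le> a\<close> vx_step[of a] vy_step[of a]
      by (auto simp: front_step_edge step_edge_def)
  next
    case (Suc s)
    then show ?case using elbow
      by (cases "pipe a s" rule: edge_cases) (fastforce split: tile.splits)+
  qed
  from this[of t] show False
    using t south south_window[of 0] east_window[of 0] assms(2) vx_mono[of ?b "int n"]
      vy_antimono[of ?b "int n"] by (auto simp: step_edge_def)
qed

text \<open>The dual invariant: the pipe stays in \<open>y \<ge> 0\<close>, so that it cannot turn north in the columns
  \<open>0 \<le> x < n - k\<close>, where the East steps among \<open>1, \<dots>, n\<close> lie.\<close>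

lemma exit_of_early_pipe:
  assumes "a \<le> 0" "exit_step a \<in> {1..int n}"
  shows "south (exit_step a)"
proof (rule ccontr)
  let ?b = "exit_step a"
  assume east: "\<not> south ?b"
  obtain t where t: "pipe a t = upper_edge k n lam ?b" using exit_step_eq_iff by blast
  have "0 \<le> snd (front (pipe a s)) \<and>
      (\<forall>x y. pipe a s = HEdge (x, y) \<longrightarrow> x < 0 \<or> int n - int k \<le> x)" for s
  proof (induction s)
    case 0
    show ?case
      using vx_mono[of a 0] vy_antimono[of a 0] \<open>a \<le> 0\<close> vx_step[of a] vy_step[of a]
      by (auto simp: front_step_edge step_edge_def)
  next
    case (Suc s)
    then show ?case using elbow
      by (cases "pipe a s" rule: edge_cases) (fastforce split: tile.splits)+
  qed
  from this[of t] show False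
    using t east east_window[of 0] assms(2) vx_mono[of ?b "int n"] vx_step[of ?b]
      vx_mono[of 0 "?b - 1"] by (auto simp: step_edge_def)
qed

lemma first_necklace_comb_exit_step: "first_necklace_comb n exit_step = lam"
proof -
  have "inv_into UNIV exit_step j \<le> 0 \<longleftrightarrow> j \<in> lam" if j: "j \<in> {1..int n}" for j
  proof -
    have "exit_step (inv_into UNIV exit_step j) = j" using exit_step_surj by (rule surj_f_inv_f)
    then have "inv_into UNIV exit_step j \<le> 0 \<longleftrightarrow> south j"
      using exit_of_early_pipe[of "inv_into UNIV exit_step j"]
        exit_of_late_pipe[of "inv_into UNIV exit_step j"] j by fastforce
    then show ?thesis using south_iff[OF j] by simp
  qed
  then show ?thesis using lam_subset unfolding first_necklace_comb_def by blast
qed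

end

text \<open>The \<open>m\<close>-th translate of the shape lies in the columns from \<open>m (n - k)\<close> to \<open>(m + 1) (n - k)\<close>, so in the
  columns \<open>0 \<le> x < n - k\<close> all elbows are in the untranslated shape, which is below height \<open>0\<close>.\<close>

lemma affine_tile_elbow:
  assumes "affine_tile k n lam D (x, y) = Elbow"
  shows "x < 0 \<or> int n - int k \<le> x \<or> y < 0"
proof (rule ccontr)
  let ?w = "int n - int k"
  assume out: "\<not> ?thesis"
  obtain m :: int where m: "0 \<le> x - m * ?w" "x - m * ?w < ?w" "y + m * int k < 0"
    using assms by (auto simp: affine_tile_def pipe_shape_def split: if_splits)
  have "0 < ?w" using out by linarith
  have "x div ?w = m"
    using m by (intro int_div_pos_eq[of _ _ _ "x - m * ?w"]) (auto simp: algebra_simps)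
  moreover have "x div ?w = 0" using out by (simp add: div_pos_pos_trivial)
  ultimately show False using m out by simp
qed

section \<open>Rank and generic minors\<close>

text \<open>A maximal independent set of columns does not contain the zero vector.\<close>

lemma (in vec_space) rank_le_card_nonzero_cols:
  assumes "A \<in> carrier_mat n nc"
  shows "rank A \<le> card (set (cols A) - {0\<^sub>v n})" and "rank A \<le> n"
proof -
  let ?P = "\<lambda>S. S \<subseteq> set (cols A) \<and> lin_indpt S"
  have "?P {}" by (auto simp: lin_dep_def)
  then obtain S where S: "maximal S ?P"
    using maximal_exists_superset[of "set (cols A)" ?P "{}"] by auto
  then have P: "S \<subseteq> set (cols A)" "lin_indpt S" by (auto simp: maximal_def)
  have car: "S \<subseteq> carrier_vec n" using P(1) cols_dim[of A] assms by auto
  have eq: "rank A = card S" using rank_card_indpt[OF assms S] .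
  have "0\<^sub>v n \<notin> S" using vs_zero_lin_dep[of S] car P(2) by simp
  then show "rank A \<le> card (set (cols A) - {0\<^sub>v n})"
    unfolding eq using P(1) by (intro card_mono) auto
  show "rank A \<le> n" unfolding eq using li_le_dim(2)[OF fin_dim, of S] car P(2) dim_is_n by simp
qed

lemma (in vec_space) distinct_lin_indpt_if_det_nonzero:
  assumes "set ws \<subseteq> carrier_vec n" "length ws = n" "det (mat_of_cols n ws) \<noteq> 0"
  shows "distinct ws" and "U \<subseteq> set ws \<Longrightarrow> lin_indpt U"
proof -
  have car: "mat_of_cols n ws \<in> carrier_mat n n" using assms(2) by (metis mat_of_cols_carrier(1))
  have rank: "rank (mat_of_cols n ws) = n" using low_rank_det_zero[OF car assms(3)] .
  then have dist: "distinct (cols (mat_of_cols n ws))"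
    using non_distinct_low_rank[OF car] by fastforce
  then show "distinct ws" using assms(1) by simp
  show "lin_indpt U" if "U \<subseteq> set ws"
    using full_rank_lin_indpt[OF car rank dist] subset_li_is_li[OF _ that] assms(1) by simp
qed

lemma entry_polynomials_sum:
  assumes "finite A" "\<And>a. a \<in> A \<Longrightarrow> f a \<in> entry_polynomials k n"
  shows "(\<lambda>M. \<Sum>a\<in>A. f a M) \<in> entry_polynomials k n"
  using assms by (induction A rule: finite_induct) (auto intro: entry_polynomials.intros)

lemma entry_polynomials_prod:
  assumes "finite A" "\<And>a. a \<in> A \<Longrightarrow> f a \<in> entry_polynomials k n"
  shows "(\<lambda>M. \<Prod>a\<in>A. f a M) \<in> entry_polynomials k n"
  using assms by (induction A rule: finite_induct) (auto intro: entry_polynomials.intros)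

lemma column_eq_col: "a \<in> {1..int n} \<Longrightarrow> column n M a = col M (nat (a - 1))"
  by (simp add: column_def)

lemma column_carrier: "M \<in> carrier_mat k n \<Longrightarrow> column n M a \<in> carrier_vec k"
  by (auto simp: column_def)

lemma maximal_minor_polynomial:
  assumes "I \<subseteq> {1..int n}" "card I = k"
  obtains p where "p \<in> entry_polynomials k n"
    "\<And>M. M \<in> carrier_mat k n \<Longrightarrow> p M = maximal_minor k n I M"
proof -
  let ?l = "sorted_list_of_set I"
  have fin: "finite I" using assms(1) finite_subset by blast
  have len: "length ?l = k" using assms(2) by simp
  have mem: "?l ! r \<in> {1..int n}" if "r < k" for r
    using that len fin assms(1) nth_mem[of r ?l] by auto
  define p :: "complex mat \<Rightarrow> complex" where "p = (\<lambda>M. \<Sum>\<pi>\<in>{\<pi>. \<pi> permutes {0..<k}}.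
      signof \<pi> * (\<Prod>r\<in>{0..<k}. M $$ (r, nat (?l ! \<pi> r - 1))))"
  have "p \<in> entry_polynomials k n"
    unfolding p_def
  proof (intro entry_polynomials_sum entry_polynomials.mult entry_polynomials_prod entry_polynomials.const
      entry_polynomials.entry)
    fix \<pi> r assume "\<pi> \<in> {\<pi>. \<pi> permutes {0..<k}}" "r \<in> {0..<k}"
    then have "\<pi> r < k" using permutes_in_image by fastforce
    then show "nat (?l ! \<pi> r - 1) < n" using mem[of "\<pi> r"] by auto
  qed (auto simp: finite_permutations)
  moreover have "p M = maximal_minor k n I M" if M: "M \<in> carrier_mat k n" for M
  proof -
    have "mat_of_cols k (map (column n M) ?l) $$ (r, \<pi> r) = M $$ (r, nat (?l ! \<pi> r - 1))"
      if "\<pi> permutes {0..<k}" "r < k" for \<pi> r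
    proof -
      have "\<pi> r < k" using that permutes_in_image by fastforce
      then show ?thesis using that M len mem[of "\<pi> r"]
        by (auto simp: mat_of_cols_index column_eq_col)
    qed
    moreover have "mat_of_cols k (map (column n M) ?l) \<in> carrier_mat k k"
      using mat_of_cols_carrier(1)[of k "map (column n M) ?l"] len by simp
    ultimately show ?thesis
      unfolding p_def maximal_minor_def by (subst det_def') (auto intro!: sum.cong prod.cong)
  qed
  ultimately show thesis using that by blast
qed

lemma zariski_closed_zero_locus:
  assumes "p \<in> entry_polynomials k n"
  shows "zariski_closed k n {M \<in> carrier_mat k n. p M = 0}"
  unfolding zariski_closed_def using assms by (intro exI[of _ "{p}"]) auto

text \<open>The nonvanishing locus of a minor is itself Zariski open, so it serves as the open set in the notion
  of genericity as soon as it meets the variety.\<close>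

lemma generic_bases_iff:
  "I \<in> generic_bases k n g \<longleftrightarrow> I \<subseteq> {1..int n} \<and> card I = k \<and>
     (\<exists>M\<in>positroid_variety k n g. maximal_minor k n I M \<noteq> 0)"
proof (cases "I \<subseteq> {1..int n} \<and> card I = k")
  case True
  let ?X = "positroid_variety k n g"
  obtain p where p: "p \<in> entry_polynomials k n"
    "\<And>M. M \<in> carrier_mat k n \<Longrightarrow> p M = maximal_minor k n I M"
    using maximal_minor_polynomial True by blast
  have X: "?X \<subseteq> carrier_mat k n" by (auto simp: positroid_variety_def)
  have "generically k n ?X (\<lambda>M. maximal_minor k n I M \<noteq> 0)"
    if "M \<in> ?X" "maximal_minor k n I M \<noteq> 0" for M
    unfolding generically_def
    using zariski_closed_zero_locus[OF p(1)] that p(2) X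
    by (intro exI[of _ "{M \<in> carrier_mat k n. p M = 0}"]) auto
  moreover have "\<exists>M\<in>?X. maximal_minor k n I M \<noteq> 0"
    if "generically k n ?X (\<lambda>M. maximal_minor k n I M \<noteq> 0)"
    using that by (auto simp: generically_def)
  ultimately show ?thesis using True by (auto simp: generic_bases_def)
qed (auto simp: generic_bases_def)

section \<open>Gale order\<close>

lemma gale_le_antisym:
  assumes "finite I" "finite J" "gale_le I J" "gale_le J I"
  shows "I = J"
proof -
  have "sorted_list_of_set I = sorted_list_of_set J"
    using assms(3,4) unfolding gale_le_def by (intro list_all2_antisym[of "(\<le>)" "(\<le>)"]) auto
  then show ?thesis using assms(1,2) by (metis set_sorted_list_of_set)
qed

text \<open>If the \<open>r\<close>-th element \<open>j\<close> of \<open>J\<close>, counted from zero, were less than the one of \<open>I\<close>, then \<open>J\<close> would have at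
  least \<open>r + 1\<close> elements up to \<open>j\<close>, and \<open>I\<close> at most \<open>r\<close>.\<close>

lemma gale_leI:
  assumes fin: "finite I" "finite J" and card: "card I = card J"
    and le: "\<And>j. j \<in> J \<Longrightarrow> card (J \<inter> {..j}) \<le> card (I \<inter> {..j})"
  shows "gale_le I J"
  unfolding gale_le_def
proof (rule list_all2_all_nthI)
  let ?i = "sorted_list_of_set I" and ?j = "sorted_list_of_set J"
  show "length ?i = length ?j" using card by simp
  fix r assume r: "r < length ?i"
  then have rj: "r < length ?j" using card by simp
  show "?i ! r \<le> ?j ! r"
  proof (rule ccontr)
    assume less: "\<not> ?i ! r \<le> ?j ! r"
    have mem: "?j ! r \<in> J" using rj fin nth_mem[of r ?j] by simp
    have "set (take (Suc r) ?j) \<subseteq> J \<inter> {..?j ! r}"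
    proof
      fix x assume "x \<in> set (take (Suc r) ?j)"
      then obtain s where "s \<le> r" "x = ?j ! s" by (auto simp: in_set_conv_nth less_Suc_eq_le)
      then show "x \<in> J \<inter> {..?j ! r}"
        using rj fin nth_mem[of s ?j] sorted_nth_mono[OF sorted_sorted_list_of_set, of s r J] by simp
    qed
    moreover have "card (set (take (Suc r) ?j)) = Suc r"
      using rj by (subst distinct_card) (auto intro: distinct_take)
    ultimately have "Suc r \<le> card (J \<inter> {..?j ! r})" using fin by (metis card_mono finite_Int)
    moreover have "I \<inter> {..?j ! r} \<subseteq> set (take r ?i)"
    proof
      fix x assume x: "x \<in> I \<inter> {..?j ! r}"
      then obtain s where s: "s < length ?i" "x = ?i ! s"
        using fin by (metis IntD1 in_set_conv_nth set_sorted_list_of_set)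
      have "s < r"
      proof (rule ccontr)
        assume "\<not> s < r"
        then have "?i ! r \<le> ?i ! s"
          using s by (intro sorted_nth_mono) auto
        then show False using less x s by auto
      qed
      then show "x \<in> set (take r ?i)" using s by (auto simp: in_set_conv_nth intro!: exI[of _ s])
    qed
    then have "card (I \<inter> {..?j ! r}) \<le> r"
      using card_mono[of "set (take r ?i)" "I \<inter> {..?j ! r}"] card_length[of "take r ?i"] by simp
    ultimately show False using le[OF mem] by linarith
  qed
qed

section \<open>The coordinate subspace of the distinguished path\<close>

context distinguished_path
begin

lemma card_lam_upto:
  assumes "j \<in> {1..int n}"
  shows "int (card (lam \<inter> {..j})) = - vy j"
proof -
  have "{a \<in> {1..j}. south a} = lam \<inter> {..j}" using assms lam_subset south_iff by force
  then show ?thesis using card_south[of 1 j] assms by simp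
qed

text \<open>The torus-fixed point of the Grassmannian belonging to \<open>\<lambda>\<close>: the columns in \<open>\<lambda>\<close> form the identity matrix,
  so all other maximal minors vanish.\<close>

definition coordinate_point :: "complex mat" where
  "coordinate_point = mat k n (\<lambda>(r, s). if sorted_list_of_set lam ! r = int s + 1 then 1 else 0)"

lemma coordinate_point_carrier: "coordinate_point \<in> carrier_mat k n"
  by (simp add: coordinate_point_def)

lemma column_coordinate_point:
  assumes "r < k"
  shows "column n coordinate_point a $ r =
    (if sorted_list_of_set lam ! r = (a - 1) mod int n + 1 then 1 else 0)"
proof -
  have "0 < n" using assms k_le_n by linarith
  then have "0 \<le> (a - 1) mod int n" "(a - 1) mod int n < int n" by simp_all
  then show ?thesis using assms by (simp add: column_def coordinate_point_def nat_less_iff)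
qed

lemma column_coordinate_point_east: "\<not> south a \<Longrightarrow> column n coordinate_point a = 0\<^sub>v k"
proof (rule eq_vecI)
  have fin: "finite lam" using lam_subset finite_subset by blast
  fix r assume "\<not> south a" "r < dim_vec (0\<^sub>v k :: complex vec)"
  then show "column n coordinate_point a $ r = 0\<^sub>v k $ r"
    using fin card_lam nth_mem[of r "sorted_list_of_set lam"]
    by (auto simp: column_coordinate_point is_south_def)
qed (use column_carrier[OF coordinate_point_carrier] in auto)

lemma maximal_minor_coordinate_point: "maximal_minor k n lam coordinate_point = 1"
proof -
  let ?l = "sorted_list_of_set lam"
  have fin: "finite lam" using lam_subset finite_subset by blast
  have "mat_of_cols k (map (column n coordinate_point) ?l) = 1\<^sub>m k"
  proof (rule eq_matI)
    fix r s assume "r < dim_row (1\<^sub>m k :: complex mat)" "s < dim_col (1\<^sub>m k :: complex mat)"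
    then have rs: "r < k" "s < k" by simp_all
    then have "?l ! s \<in> {1..int n}" using fin card_lam lam_subset nth_mem[of s ?l] by auto
    then have "(?l ! s - 1) mod int n + 1 = ?l ! s" by simp
    moreover have "?l ! r = ?l ! s \<longleftrightarrow> r = s"
      using rs card_lam by (intro nth_eq_iff_index_eq) auto
    ultimately show "mat_of_cols k (map (column n coordinate_point) ?l) $$ (r, s) = 1\<^sub>m k $$ (r, s)"
      using rs card_lam by (auto simp: mat_of_cols_index column_coordinate_point)
  qed (use card_lam in auto)
  then show ?thesis by (simp add: maximal_minor_def)
qed

lemma rank_coordinate_point: "vec_space.rank k coordinate_point = k"
proof -
  let ?ws = "map (column n coordinate_point) (sorted_list_of_set lam)"
  have fin: "finite lam" using lam_subset finite_subset by blast
  have ws: "set ?ws \<subseteq> carrier_vec k" "length ?ws = k"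
    using column_carrier[OF coordinate_point_carrier] card_lam by auto
  note indep = vec_space.distinct_lin_indpt_if_det_nonzero[OF ws]
  have "set ?ws \<subseteq> set (cols coordinate_point)"
  proof
    fix v assume "v \<in> set ?ws"
    then obtain a where a: "a \<in> {1..int n}" "v = column n coordinate_point a" using fin lam_subset by auto
    then have "v = cols coordinate_point ! nat (a - 1)" "nat (a - 1) < length (cols coordinate_point)"
      using column_eq_col[OF a(1)] coordinate_point_carrier by auto
    then show "v \<in> set (cols coordinate_point)" using nth_mem by metis
  qed
  then have "card (set ?ws) \<le> vec_space.rank k coordinate_point"
    using indep maximal_minor_coordinate_point coordinate_point_carrier
    by (intro vec_space.rank_ge_card_indpt) (auto simp: maximal_minor_def)
  moreover have "card (set ?ws) = k"
    using indep(1) maximal_minor_coordinate_point ws by (metis distinct_card maximal_minor_def zero_neq_one)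
  ultimately show ?thesis
    using vec_space.rank_le_card_nonzero_cols(2)[OF coordinate_point_carrier] by simp
qed

lemma rank_coordinate_point_interval:
  fixes i j
  defines "A \<equiv> mat_of_cols k (map (column n coordinate_point) [i..j])"
  shows "vec_space.rank k A \<le> card {a \<in> {i..j}. south a}" "vec_space.rank k A \<le> k"
proof -
  have car: "A \<in> carrier_mat k (length [i..j])"
    unfolding A_def using mat_of_cols_carrier(1)[of k "map (column n coordinate_point) [i..j]"] by simp
  have "cols A = map (column n coordinate_point) [i..j]"
    unfolding A_def using column_carrier[OF coordinate_point_carrier] by (intro cols_mat_of_cols) auto
  then have "set (cols A) - {0\<^sub>v k} \<subseteq> column n coordinate_point ` {a \<in> {i..j}. south a}"
    using column_coordinate_point_east by fastforce
  moreover have "finite {a \<in> {i..j}. south a}"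
    by (rule finite_subset[of _ "{i..j}"]) auto
  ultimately have "card (set (cols A) - {0\<^sub>v k}) \<le> card {a \<in> {i..j}. south a}"
    by (meson card_image_le card_mono finite_imageI le_trans)
  then show "vec_space.rank k A \<le> card {a \<in> {i..j}. south a}"
    using vec_space.rank_le_card_nonzero_cols(1)[OF car] by linarith
  show "vec_space.rank k A \<le> k" using vec_space.rank_le_card_nonzero_cols(2)[OF car] .
qed

end

section \<open>The first Grassmann necklace element\<close>

context pipe_strip
begin

text \<open>Only the columns of South steps are nonzero, so the rank of the columns \<open>i, \<dots>, j\<close> is at most the
  number of South steps there, and the condition follows from the bound on the number of pipes by the
  number of East steps.\<close>

lemma coordinate_point_in_positroid_variety: "coordinate_point \<in> positroid_variety k n exit_step"
proof -
  have "int (vec_space.rank k (mat_of_cols k (map (column n coordinate_point) [i..j])))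
      \<le> (j - i + 1) - int (card {a. i \<le> a \<and> exit_step a \<le> j})" (is "int ?rank \<le> _")
    if ij: "i \<le> j" "j \<le> i + int n" for i j
  proof (cases "vy (i - 1) - vy j \<le> int k")
    case True
    have "int (card {a. i \<le> a \<and> exit_step a \<le> j}) \<le> vx j - vx (i - 1)"
      using card_exits_le_east(2)[OF True] vx_mono[of "i - 1" j] ij by simp
    moreover have "int ?rank \<le> vy (i - 1) - vy j"
      using rank_coordinate_point_interval(1)[of i j] card_south[of i j] ij by linarith
    ultimately show ?thesis using vx_minus_vy[of j] vx_minus_vy[of "i - 1"] by linarith
  next
    case False
    \<comment> \<open>A window of \<open>n\<close> steps has only \<open>k\<close> South steps, so this is a window of \<open>n + 1\<close> steps.  Its columns
       still have rank at most \<open>k\<close>, and without its last step it has at most one pipe less.\<close>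
    have j: "j = i + int n"
      using False ij south_window[of "i - 1"] vy_antimono[of j "i - 1 + int n"] by linarith
    have window: "vy (i - 1) - vy (j - 1) = int k" "vx (j - 1) - vx (i - 1) = int n - int k"
      using south_window[of "i - 1"] east_window[of "i - 1"] unfolding j by (simp_all add: algebra_simps)
    let ?A = "{a. i \<le> a \<and> exit_step a \<le> j - 1}"
    have A: "finite ?A" "int (card ?A) \<le> int n - int k"
      using card_exits_le_east[of i "j - 1"] window k_le_n by auto
    have "{a. i \<le> a \<and> exit_step a \<le> j} \<subseteq> insert (inv_into UNIV exit_step j) ?A"
      using inv_f_f[OF exit_step_inj] by (force simp: order_le_less)
    then have "card {a. i \<le> a \<and> exit_step a \<le> j} \<le> card (insert (inv_into UNIV exit_step j) ?A)"
      using A(1) by (intro card_mono) auto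
    also have "\<dots> \<le> Suc (card ?A)" using A(1) by (simp add: card_insert_if)
    finally have "card {a. i \<le> a \<and> exit_step a \<le> j} \<le> Suc (card ?A)" .
    then show ?thesis using rank_coordinate_point_interval(2)[of i j] A(2) j by linarith
  qed
  then show ?thesis
    unfolding positroid_variety_def using coordinate_point_carrier rank_coordinate_point by blast
qed

lemma lam_generic_basis: "lam \<in> generic_bases k n exit_step"
  unfolding generic_bases_iff
  using lam_subset card_lam coordinate_point_in_positroid_variety maximal_minor_coordinate_point by force

end

context confined_strip
begin

text \<open>Of the first \<open>j\<close> exit steps, the East ones belong to pipes that start at a step \<open>\<ge> 1\<close>, so each of them
  lowers the bound on the rank by one.\<close>

lemma positroid_rank_initial:
  assumes M: "M \<in> positroid_variety k n exit_step" and j: "j \<in> {1..int n}"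
  shows "vec_space.rank k (mat_of_cols k (map (column n M) [1..j])) \<le> card (lam \<inter> {..j})"
proof -
  let ?A = "{a. 1 \<le> a \<and> exit_step a \<le> j}"
  have fin: "finite ?A"
    using card_exits_le_east(1)[of 1 j] south_window[of 0] vy_antimono[of j "int n"] j by simp
  have "{b \<in> {1..j}. \<not> south b} \<subseteq> exit_step ` ?A"
  proof
    fix b assume b: "b \<in> {b \<in> {1..j}. \<not> south b}"
    have eq: "exit_step (inv_into UNIV exit_step b) = b" using exit_step_surj by (rule surj_f_inv_f)
    then have "1 \<le> inv_into UNIV exit_step b"
      using exit_of_early_pipe[of "inv_into UNIV exit_step b"] b j by fastforce
    then show "b \<in> exit_step ` ?A" using eq b by (intro image_eqI[of _ _ "inv_into UNIV exit_step b"]) auto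
  qed
  then have "vx j \<le> int (card ?A)"
    using card_mono[OF finite_imageI[OF fin]] card_image_le[OF fin, of exit_step] card_east[of 1 j] j
    by fastforce
  moreover have "int (vec_space.rank k (mat_of_cols k (map (column n M) [1..j]))) \<le> j - int (card ?A)"
    using M j unfolding positroid_variety_def by force
  ultimately show ?thesis using card_lam_upto[OF j] vx_minus_vy[of j] by linarith
qed

lemma lam_gale_le_generic_basis:
  assumes J: "J \<in> generic_bases k n exit_step"
  shows "gale_le lam J"
proof -
  obtain M where M: "M \<in> positroid_variety k n exit_step" "maximal_minor k n J M \<noteq> 0"
    and J': "J \<subseteq> {1..int n}" "card J = k"
    using J by (auto simp: generic_bases_iff)
  have fin: "finite J" using J' finite_subset by blast
  have car: "M \<in> carrier_mat k n" using M by (simp add: positroid_variety_def)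
  let ?ws = "map (column n M) (sorted_list_of_set J)"
  have ws: "set ?ws \<subseteq> carrier_vec k" "length ?ws = k" using column_carrier[OF car] J' by auto
  note indep = vec_space.distinct_lin_indpt_if_det_nonzero[OF ws M(2)[unfolded maximal_minor_def]]
  have inj: "inj_on (column n M) J" using indep(1) fin by (simp add: distinct_map)
  have "card (J \<inter> {..j}) \<le> card (lam \<inter> {..j})" if "j \<in> J" for j
  proof -
    have j: "j \<in> {1..int n}" using that J' by blast
    let ?A = "mat_of_cols k (map (column n M) [1..j])" and ?U = "column n M ` (J \<inter> {..j})"
    have cols: "cols ?A = map (column n M) [1..j]" using column_carrier[OF car] by (intro cols_mat_of_cols) auto
    have "card (J \<inter> {..j}) = card ?U" using inj by (simp add: card_image inj_on_Int)
    also have "\<dots> \<le> vec_space.rank k ?A"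
    proof (rule vec_space.rank_ge_card_indpt)
      show "?A \<in> carrier_mat k (length [1..j])" using mat_of_cols_carrier(1)[of k "map (column n M) [1..j]"] by simp
      show "?U \<subseteq> set (cols ?A)" unfolding cols using J' by auto
      show "\<not> module.lin_dep class_ring (module_vec TYPE(complex) k) ?U"
        using fin by (intro indep(2)) auto
    qed
    also have "\<dots> \<le> card (lam \<inter> {..j})" using positroid_rank_initial[OF M(1) j] .
    finally show ?thesis .
  qed
  then show ?thesis
    using fin lam_subset J' card_lam by (intro gale_leI) (auto intro: finite_subset)
qed

lemma first_necklace_exit_step: "first_necklace k n exit_step = lam"
  unfolding first_necklace_def
proof (rule the_equality)
  show "lam \<in> generic_bases k n exit_step \<and> (\<forall>J\<in>generic_bases k n exit_step. gale_le lam J)"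
    using lam_generic_basis lam_gale_le_generic_basis by blast
next
  fix I assume I: "I \<in> generic_bases k n exit_step \<and> (\<forall>J\<in>generic_bases k n exit_step. gale_le I J)"
  then have "I \<subseteq> {1..int n}" by (simp add: generic_bases_def)
  then show "I = lam"
    using I lam_generic_basis lam_gale_le_generic_basis lam_subset
    by (intro gale_le_antisym) (auto intro: finite_subset)
qed

end

theorem proposition15:
  fixes n k :: nat and lam :: "int set" and D :: "int \<times> int \<Rightarrow> tile"
  assumes "lam \<subseteq> {1..int n}" and "card lam = k"
  shows "first_necklace k n (pipe_dream_perm k n lam D) = lam \<and>
         first_necklace_comb n (pipe_dream_perm k n lam D) = lam"
proof -
  interpret confined_strip n k lam "affine_tile k n lam D"
    using assms affine_tile_elbow by unfold_locales auto
  have "pipe_dream_perm k n lam D = exit_step"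
    by (simp add: fun_eq_iff pipe_dream_perm_def pipe_edge_def exit_step_def)
  then show ?thesis
    using first_necklace_exit_step first_necklace_comb_exit_step by simp
qed

end
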